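(* Let $\alpha\in(0,1)$. In the sparse one-sided Gaussian location model $\mathbf P^{(m)}_{b,c,\beta}$ (with $b>0$, $c\in(0,1)$, $\beta\in[0,1)$), the number of rejections $\hat k_\alpha$ of the Benjamini–Hochberg procedure at level $\alpha$ is such that, as $m$ grows to infinity, $$\mathbf P^{(m)}_{b,c,\beta}\bigl(t^*_m\le\alpha\hat k_\alpha/m\le t^\sharp_m\bigr)\ge1-2e^{-d m_1},\qquad\text{for } m_1/m\lesssim t^*_m\le t^\sharp_m\lesssim m_1/m,$$ for some constant $d>0$ (depending on $\alpha,\beta,b$), where $t^*_m\in(0,1)$ is the unique solution of $G_m(t)=2t/\alpha$, $t^\sharp_m\in(0,1)$ is the unique solution of $G_m(t)=0.5\,t/\alpha$, and where $G_m(t)=(m_0/m)\,t+(m_1/m)\,\overline\Phi(\overline\Phi^{-1}(t)-\mu_m)$, with $\overline\Phi(z)=\mathbf P(Z\ge z)$, $z\in\mathbb R$, for $Z\sim\mathcal N(0,1)$.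
   Context: Model $\mathbf P^{(m)}_{b,c,\beta}$: $p_i=\overline\Phi(X_i)$, $1\le i\le m$; the $X_i$ are independent, $X_i\sim\mathcal N(0,1)$ for $i\in\mathcal H_0$ and $X_i\sim\mathcal N(\mu_m,1)$ for $i\in\mathcal H_1=\{1,\dots,m\}\setminus\mathcal H_0$, with $\mu_m=\sqrt{2\beta\log m}+b$, $m_1=|\mathcal H_1|=\lfloor cm^{1-\beta}\rfloor$ and $m_0=|\mathcal H_0|=m-m_1$. With ordered $p$-values $p_{(1)}\le\dots\le p_{(m)}$, $\hat k_\alpha=\max\{k: mp_{(k)}/k\le\alpha\}$ ($=0$ if there is no such $k\in\{1,\dots,m\}$). $u_m\lesssim v_m$ means $u_m\le Cv_m$ for $m$ large enough, for some constant $C>0$ not depending on $m$.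
   Formalization: Claims about t♯ are made for α<1/2 only, since for α≥1/2 the equation G_m(t)=0.5t/α has no solution in (0,1) once m_1≥1 (the t* part is kept for all α in (0,1)); for β=0 the constant d may also depend on c, since a choice uniform in c is impossible. *)

theory Defs
  imports "HOL-Probability.Probability"
begin

definition lesssim :: "(nat \<Rightarrow> real) \<Rightarrow> (nat \<Rightarrow> real) \<Rightarrow> bool" where
  "lesssim u v \<longleftrightarrow> (\<exists>C>0. \<forall>\<^sub>F m in sequentially. u m \<le> C * v m)"

definition Phi_bar :: "real \<Rightarrow> real" where
  "Phi_bar z = measure std_normal_distribution {z..}"

text \<open>
  \<open>Phi_bar\<close> is a bijection of the real line onto the open unit interval, so
  \<open>inv Phi_bar t\<close> is meaningful for \<open>0 < t < 1\<close> only.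
\<close>

definition mu :: "real \<Rightarrow> real \<Rightarrow> nat \<Rightarrow> real" where
  "mu b \<beta> m = sqrt (2 * \<beta> * ln (real m)) + b"

definition m1 :: "real \<Rightarrow> real \<Rightarrow> nat \<Rightarrow> nat" where
  "m1 c \<beta> m = nat \<lfloor>c * real m powr (1 - \<beta>)\<rfloor>"

definition m0 :: "real \<Rightarrow> real \<Rightarrow> nat \<Rightarrow> nat" where
  "m0 c \<beta> m = m - m1 c \<beta> m"

text \<open>
  The law of \<open>(X\<^sub>1, \<dots>, X\<^sub>m)\<close> with set of true nulls \<open>H0\<close>; the \<open>X\<^sub>i\<close> are the coordinate maps.
\<close>

definition gauss_model :: "real \<Rightarrow> real \<Rightarrow> nat \<Rightarrow> nat set \<Rightarrow> (nat \<Rightarrow> real) measure" where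
  "gauss_model b \<beta> m H0 =
     (\<Pi>\<^sub>M i\<in>{1..m}. density lborel
        (\<lambda>x. ennreal (normal_density (if i \<in> H0 then 0 else mu b \<beta> m) 1 x)))"

definition null_set :: "real \<Rightarrow> real \<Rightarrow> nat \<Rightarrow> nat set \<Rightarrow> bool" where
  "null_set c \<beta> m H0 \<longleftrightarrow> H0 \<subseteq> {1..m} \<and> card H0 = m0 c \<beta> m"

definition ordered_pvalue :: "nat \<Rightarrow> (nat \<Rightarrow> real) \<Rightarrow> nat \<Rightarrow> real" where
  "ordered_pvalue m X k = sort (map (\<lambda>i. Phi_bar (X i)) [1..<Suc m]) ! (k - 1)"

definition bh_rejections :: "real \<Rightarrow> nat \<Rightarrow> (nat \<Rightarrow> real) \<Rightarrow> nat" where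
  "bh_rejections \<alpha> m X =
     Max (insert 0 {k\<in>{1..m}. real m * ordered_pvalue m X k / real k \<le> \<alpha>})"

definition G :: "real \<Rightarrow> real \<Rightarrow> real \<Rightarrow> nat \<Rightarrow> real \<Rightarrow> real" where
  "G b c \<beta> m t = (real (m0 c \<beta> m) / real m) * t
     + (real (m1 c \<beta> m) / real m) * Phi_bar (inv Phi_bar t - mu b \<beta> m)"

definition t_star :: "real \<Rightarrow> real \<Rightarrow> real \<Rightarrow> real \<Rightarrow> nat \<Rightarrow> real" where
  "t_star \<alpha> b c \<beta> m = (THE t. 0 < t \<and> t < 1 \<and> G b c \<beta> m t = 2 * t / \<alpha>)"

definition t_sharp :: "real \<Rightarrow> real \<Rightarrow> real \<Rightarrow> real \<Rightarrow> nat \<Rightarrow> real" where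
  "t_sharp \<alpha> b c \<beta> m = (THE t. 0 < t \<and> t < 1 \<and> G b c \<beta> m t = 0.5 * t / \<alpha>)"

lemma real_distribution_std_normal: "real_distribution std_normal_distribution"
  using prob_space_normal_density[of 1 0]
  by (simp add: real_distribution_def real_distribution_axioms_def)

lemma measure_std_normal_singleton: "measure std_normal_distribution {x} = 0"
proof -
  have "emeasure std_normal_distribution {x} = 0"
    by (subst emeasure_density) (auto simp: nn_integral_0_iff_AE intro!: AE_mp[OF AE_lborel_singleton[of x]])
  thus ?thesis by (simp add: measure_def)
qed

lemma Phi_bar_eq_cdf: "Phi_bar z = 1 - cdf std_normal_distribution z"
proof -
  interpret real_distribution std_normal_distribution by (rule real_distribution_std_normal)
  have "Phi_bar z = measure std_normal_distribution {z<..}"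
  proof -
    have "{z..} = {z} \<union> {z<..}" by auto
    hence "Phi_bar z = measure std_normal_distribution {z} + measure std_normal_distribution {z<..}"
      unfolding Phi_bar_def by (simp only:, subst finite_measure_Union) auto
    thus ?thesis by (simp add: measure_std_normal_singleton)
  qed
  also have "\<dots> = 1 - cdf std_normal_distribution z"
  proof -
    have "{z<..} = space std_normal_distribution - {..z}" by auto
    thus ?thesis unfolding cdf_def using prob_compl[of "{..z}"] by simp
  qed
  finally show ?thesis .
qed

lemma Phi_bar_strict: assumes "x < y" shows "Phi_bar y < Phi_bar x"
proof -
  interpret real_distribution std_normal_distribution by (rule real_distribution_std_normal)
  have "emeasure std_normal_distribution {x<..y} \<noteq> 0"
  proof
    assume "emeasure std_normal_distribution {x<..y} = 0"
    hence "AE z in lborel. ennreal (std_normal_density z) * indicator {x<..y} z = 0"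
      by (subst (asm) emeasure_density) (auto simp: nn_integral_0_iff_AE)
    hence "AE z in lborel. z \<notin> {x<..y}"
    proof eventually_elim
      case (elim z)
      have "\<not> std_normal_density z \<le> 0" using normal_density_pos[of 1 0 z] by linarith
      with elim show ?case by (auto simp: indicator_def ennreal_eq_0_iff split: if_splits)
    qed
    hence "emeasure lborel {x<..y} = 0"
      by (subst (asm) AE_iff_measurable[where N = "{x<..y}"]) auto
    thus False using assms by simp
  qed
  hence "measure std_normal_distribution {x<..y} > 0"
    by (simp add: emeasure_eq_measure zero_less_measure_iff)
  thus ?thesis using cdf_diff_eq[OF assms] by (simp add: Phi_bar_eq_cdf)
qed

lemma Phi_bar_surj: assumes "0 < t" "t < 1" shows "\<exists>z. Phi_bar z = t"
proof -
  interpret real_distribution std_normal_distribution by (rule real_distribution_std_normal)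
  have c: "\<forall>x. isCont (cdf std_normal_distribution) x"
    using isCont_cdf measure_std_normal_singleton by blast
  have "eventually (\<lambda>x. cdf std_normal_distribution x < 1 - t) at_bot"
    using order_tendstoD(2)[OF cdf_lim_at_bot] assms by simp
  then obtain x where x: "cdf std_normal_distribution x < 1 - t"
    using eventually_happens' trivial_limit_at_bot_linorder by blast
  have "eventually (\<lambda>y. 1 - t < cdf std_normal_distribution y) at_top"
    using order_tendstoD(1)[OF cdf_lim_at_top_prob] assms by simp
  then obtain y where y: "1 - t < cdf std_normal_distribution y"
    using eventually_happens' trivial_limit_at_top_linorder by blast
  have "x \<le> y" using x y cdf_nondecreasing[of y x] by linarith
  then obtain z where "cdf std_normal_distribution z = 1 - t"
    using IVT[of "cdf std_normal_distribution" x "1 - t" y] x y c by auto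
  thus ?thesis by (intro exI[of _ z]) (simp add: Phi_bar_eq_cdf)
qed

lemma m1_le: assumes "0 < c" "c < 1" "0 \<le> \<beta>" shows "m1 c \<beta> m \<le> m"
proof (cases "m = 0")
  case False
  have "real m powr (1 - \<beta>) \<le> real m powr 1" using False assms by (intro powr_mono) auto
  hence "c * real m powr (1 - \<beta>) \<le> 1 * real m" using False assms by (intro mult_mono) auto
  thus ?thesis unfolding m1_def by linarith
qed (simp add: m1_def)

text \<open>
  \<open>t_sharp\<close> only exists for \<open>\<alpha> < 1/2\<close>: \<open>G\<close> lies strictly above the diagonal.
\<close>

lemma G_greater_diagonal:
  assumes "0 < b" "0 < c" "c < 1" "0 \<le> \<beta>" "0 < m1 c \<beta> m" "0 < t" "t < 1"
  shows "t < G b c \<beta> m t"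
proof -
  have le: "m1 c \<beta> m \<le> m" using assms by (intro m1_le) auto
  hence m: "0 < m" using assms by linarith
  have "0 \<le> ln (real m)" using m by simp
  hence "0 < mu b \<beta> m" unfolding mu_def using assms by (intro add_nonneg_pos) auto
  hence "Phi_bar (inv Phi_bar t) < Phi_bar (inv Phi_bar t - mu b \<beta> m)"
    by (intro Phi_bar_strict) simp
  moreover have "Phi_bar (inv Phi_bar t) = t"
    using Phi_bar_surj[OF assms(6,7)] by (intro f_inv_into_f) auto
  ultimately have "(real (m1 c \<beta> m) / real m) * t
      < (real (m1 c \<beta> m) / real m) * Phi_bar (inv Phi_bar t - mu b \<beta> m)"
    using assms m by (intro mult_strict_left_mono) auto
  moreover have "(real (m0 c \<beta> m) / real m) * t + (real (m1 c \<beta> m) / real m) * t = t"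
    using le m by (simp add: m0_def of_nat_diff field_simps)
  ultimately show ?thesis unfolding G_def by linarith
qed

lemma no_t_sharp:
  assumes "0 < b" "0 < c" "c < 1" "0 \<le> \<beta>" "0 < m1 c \<beta> m" "1/2 \<le> \<alpha>"
  shows "\<nexists>t. 0 < t \<and> t < 1 \<and> G b c \<beta> m t = 0.5 * t / \<alpha>"
proof
  assume "\<exists>t. 0 < t \<and> t < 1 \<and> G b c \<beta> m t = 0.5 * t / \<alpha>"
  then obtain t where t: "0 < t" "t < 1" "G b c \<beta> m t = 0.5 * t / \<alpha>" by blast
  have "0.5 * t / \<alpha> \<le> t" using assms(6) t(1) by (simp add: field_simps)
  with G_greater_diagonal[OF assms(1-5) t(1,2)] t(3) show False by linarith
qed

text \<open>
  For \<open>\<beta> = 0\<close> the rate in the deviation bound cannot be chosen uniformly in \<open>c\<close>: then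
  \<open>t_star / c\<close> tends to \<open>0\<close> as \<open>c\<close> does (with \<open>m\<close> large), while fewer than \<open>t_star * m / \<alpha>\<close> rejections
  occur with probability at least of order \<open>exp (- C * m * s)\<close> where again \<open>s / c\<close> tends to \<open>0\<close>.
  For \<open>\<beta> > 0\<close> it can.
\<close>

end

theory Submission
  imports Defs "HOL-Real_Asymp.Real_Asymp"
begin

text \<open>
  In the coordinate \<open>z = Phi_bar\<^sup>-\<^sup>1 t\<close> the slope \<open>G t / t\<close> is an increasing affine function of the
  ratio \<open>R z = Phi_bar (z - \<mu>) / Phi_bar z\<close>. Exponential tilting (the likelihood ratio
  \<open>exp (\<mu> x - \<mu>\<^sup>2 / 2)\<close> of the two Gaussian laws is increasing in \<open>x\<close>) shows that \<open>R\<close> increases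
  strictly from \<open>1\<close> to infinity and dominates \<open>exp (\<mu> z - \<mu>\<^sup>2 / 2)\<close>. So \<open>G t = y t\<close> has exactly one
  solution for each \<open>y > 1\<close>. There the ratio is at most of order \<open>m / m1\<close>; as \<open>exp (\<mu>\<^sup>2 / 2)\<close> is of
  larger order when \<open>\<beta> > 0\<close>, the quantile of the solution is eventually at most \<open>\<mu>\<close>, so that a fixed
  proportion of the alternatives lies below the solution, which is therefore at least of order
  \<open>m1 / m\<close>.

  The number of p-values below \<open>t\<close> is a sum of independent indicators with mean \<open>m G t\<close>. The
  procedure stops below \<open>t_star\<close> only if this number is at most half its mean at \<open>t_star\<close>; it goes
  beyond \<open>t_sharp\<close> only if at some \<open>t = \<alpha> k / m > t_sharp\<close> it is at least \<open>k\<close>, which is at least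
  twice its mean. Chernoff bounds and a geometric sum over \<open>k\<close> finish the argument.
\<close>

subsection \<open>Gaussian tails\<close>

abbreviation normal_law :: "real \<Rightarrow> real measure" where
  "normal_law a \<equiv> density lborel (\<lambda>x. ennreal (normal_density a 1 x))"

lemma prob_space_normal_law: "prob_space (normal_law a)"
  by (rule prob_space_normal_density) simp

lemma Phi_bar_less_iff [simp]: "Phi_bar x < Phi_bar y \<longleftrightarrow> y < x"
  using Phi_bar_strict by (metis less_irrefl less_trans linorder_neqE)

lemma Phi_bar_le_iff [simp]: "Phi_bar x \<le> Phi_bar y \<longleftrightarrow> y \<le> x"
  by (metis Phi_bar_less_iff not_less)

lemma Phi_bar_pos: "0 < Phi_bar z"
proof -
  have "0 \<le> Phi_bar (z + 1)" by (simp add: Phi_bar_def)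
  also have "\<dots> < Phi_bar z" by simp
  finally show ?thesis .
qed

lemma Phi_bar_less_1: "Phi_bar z < 1"
proof -
  interpret prob_space "normal_law 0" by (rule prob_space_normal_law)
  have "Phi_bar z < Phi_bar (z - 1)" by simp
  also have "\<dots> \<le> 1" by (simp add: Phi_bar_def)
  finally show ?thesis .
qed

lemma Phi_bar_inv: "0 < t \<Longrightarrow> t < 1 \<Longrightarrow> Phi_bar (inv Phi_bar t) = t"
  using Phi_bar_surj by (intro f_inv_into_f) auto

lemma inv_Phi_bar [simp]: "inv Phi_bar (Phi_bar z) = z"
  by (rule inv_f_f) (metis Phi_bar_less_iff injI linorder_neqE order_less_irrefl)

lemma inv_Phi_bar_less: "0 < s \<Longrightarrow> s < t \<Longrightarrow> t < 1 \<Longrightarrow> inv Phi_bar t < inv Phi_bar s"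
  using Phi_bar_less_iff[of "inv Phi_bar s" "inv Phi_bar t"] by (simp add: Phi_bar_inv)

lemma Phi_bar_le_iff_inv_le: "0 < t \<Longrightarrow> t < 1 \<Longrightarrow> Phi_bar x \<le> t \<longleftrightarrow> inv Phi_bar t \<le> x"
  using Phi_bar_le_iff[of x "inv Phi_bar t"] by (simp add: Phi_bar_inv)

lemma isCont_Phi_bar: "isCont Phi_bar z"
proof -
  interpret real_distribution std_normal_distribution by (rule real_distribution_std_normal)
  have "isCont (cdf std_normal_distribution) z"
    using isCont_cdf measure_std_normal_singleton by blast
  thus ?thesis unfolding Phi_bar_eq_cdf[abs_def] by (intro continuous_intros)
qed

lemma borel_measurable_Phi_bar [measurable]: "Phi_bar \<in> borel_measurable borel"
  by (intro borel_measurable_continuous_onI continuous_at_imp_continuous_on ballI isCont_Phi_bar)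

lemma tendsto_Phi_bar_at_bot: "(Phi_bar \<longlongrightarrow> 1) at_bot"
proof -
  interpret real_distribution std_normal_distribution by (rule real_distribution_std_normal)
  have "((\<lambda>z. 1 - cdf std_normal_distribution z) \<longlongrightarrow> 1 - 0) at_bot"
    by (intro tendsto_intros cdf_lim_at_bot)
  thus ?thesis unfolding Phi_bar_eq_cdf[abs_def] by simp
qed

lemma measure_normal_law_atLeast: "measure (normal_law a) {z..} = Phi_bar (z - a)"
proof -
  have "emeasure (normal_law a) {z..}
      = (\<integral>\<^sup>+x. ennreal (normal_density a 1 x) * indicator {z..} x \<partial>lborel)"
    by (subst emeasure_density) auto
  also have "\<dots> = (\<integral>\<^sup>+x. ennreal (normal_density a 1 (a + 1 * x)) * indicator {z..} (a + 1 * x) \<partial>lborel)"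
    by (subst nn_integral_real_affine[of _ 1 a]) auto
  also have "\<dots> = (\<integral>\<^sup>+x. ennreal (std_normal_density x) * indicator {z - a..} x \<partial>lborel)"
    by (intro nn_integral_cong) (auto simp: normal_density_def indicator_def)
  also have "\<dots> = emeasure std_normal_distribution {z - a..}"
    by (subst emeasure_density) auto
  finally show ?thesis by (simp add: measure_def Phi_bar_def)
qed

lemma measure_normal_law_atLeastLessThan:
  assumes "y \<le> z"
  shows "measure (normal_law a) {y..<z} = Phi_bar (y - a) - Phi_bar (z - a)"
proof -
  interpret prob_space "normal_law a" by (rule prob_space_normal_law)
  have "{y..<z} = {y..} - {z..}" by auto
  hence "prob {y..<z} = prob {y..} - prob {z..}"
    using assms by (simp only:, intro finite_measure_Diff) auto
  thus ?thesis by (simp add: measure_normal_law_atLeast)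
qed

lemma normal_density_tilt:
  "normal_density a 1 x = exp ((a - a') * x - (a\<^sup>2 - a'\<^sup>2) / 2) * normal_density a' 1 x"
  by (simp add: normal_density_def flip: exp_add) (simp add: power2_eq_square field_simps)

lemma measure_normal_law_tilt_ge:
  assumes "S \<in> sets borel" and "\<And>x. x \<in> S \<Longrightarrow> (a - a') * z \<le> (a - a') * x"
  defines "L \<equiv> exp ((a - a') * z - (a\<^sup>2 - a'\<^sup>2) / 2)"
  shows "L * measure (normal_law a') S \<le> measure (normal_law a) S"
proof -
  interpret N: prob_space "normal_law a" by (rule prob_space_normal_law)
  interpret N': prob_space "normal_law a'" by (rule prob_space_normal_law)
  have "ennreal L * emeasure (normal_law a') S
     = (\<integral>\<^sup>+x. ennreal L * (ennreal (normal_density a' 1 x) * indicator S x) \<partial>lborel)"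
    using assms(1) by (subst emeasure_density) (auto simp: nn_integral_cmult)
  also have "\<dots> \<le> (\<integral>\<^sup>+x. ennreal (normal_density a 1 x) * indicator S x \<partial>lborel)"
  proof (intro nn_integral_mono)
    fix x
    have "L * normal_density a' 1 x \<le> normal_density a 1 x" if "x \<in> S"
      unfolding normal_density_tilt[of a x a'] L_def using assms(2)[OF that]
      by (intro mult_right_mono) auto
    thus "ennreal L * (ennreal (normal_density a' 1 x) * indicator S x)
        \<le> ennreal (normal_density a 1 x) * indicator S x"
      by (auto simp: indicator_def L_def simp flip: ennreal_mult intro!: ennreal_leI)
  qed
  also have "\<dots> = emeasure (normal_law a) S"
    using assms(1) by (subst emeasure_density) auto
  finally show ?thesis
    by (simp add: N.emeasure_eq_measure N'.emeasure_eq_measure L_def flip: ennreal_mult)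
qed

lemma Phi_bar_shift_ge:
  "0 \<le> a \<Longrightarrow> exp (a * z - a\<^sup>2 / 2) * Phi_bar z \<le> Phi_bar (z - a)"
  using measure_normal_law_tilt_ge[of "{z..}" a 0 z]
  by (simp add: measure_normal_law_atLeast mult_left_mono)

lemma Phi_bar_shift_diff_le:
  assumes "0 \<le> a" "y \<le> z"
  shows "Phi_bar (y - a) - Phi_bar (z - a) \<le> exp (a * z - a\<^sup>2 / 2) * (Phi_bar y - Phi_bar z)"
proof -
  have "exp (- (a * z - a\<^sup>2 / 2)) * measure (normal_law a) {y..<z} \<le> measure (normal_law 0) {y..<z}"
    using measure_normal_law_tilt_ge[of "{y..<z}" 0 a z] assms by (simp add: mult_left_mono)
  thus ?thesis
    using assms by (simp add: measure_normal_law_atLeastLessThan exp_minus field_simps)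
qed

lemma Phi_bar_shift_diff_less:
  assumes "0 < a" "y < z"
  shows "Phi_bar (y - a) - Phi_bar (z - a) < exp (a * z - a\<^sup>2 / 2) * (Phi_bar y - Phi_bar z)"
proof -
  obtain w where between: "y < w" "w < z" using dense[OF assms(2)] by blast
  have "Phi_bar (y - a) - Phi_bar (w - a) \<le> exp (a * w - a\<^sup>2 / 2) * (Phi_bar y - Phi_bar w)"
    using assms between by (intro Phi_bar_shift_diff_le) auto
  also have "\<dots> < exp (a * z - a\<^sup>2 / 2) * (Phi_bar y - Phi_bar w)"
    using assms between by (intro mult_strict_right_mono) auto
  finally have "Phi_bar (y - a) - Phi_bar (w - a) < exp (a * z - a\<^sup>2 / 2) * (Phi_bar y - Phi_bar w)" .
  moreover have "Phi_bar (w - a) - Phi_bar (z - a) \<le> exp (a * z - a\<^sup>2 / 2) * (Phi_bar w - Phi_bar z)"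
    using assms between by (intro Phi_bar_shift_diff_le) auto
  ultimately show ?thesis by (simp add: algebra_simps)
qed

definition tail_ratio :: "real \<Rightarrow> real \<Rightarrow> real" where
  "tail_ratio a z = Phi_bar (z - a) / Phi_bar z"

lemma tail_ratio_ge: "0 \<le> a \<Longrightarrow> exp (a * z - a\<^sup>2 / 2) \<le> tail_ratio a z"
  using Phi_bar_shift_ge[of a z] Phi_bar_pos[of z] by (simp add: tail_ratio_def field_simps)

lemma tail_ratio_strict_mono:
  assumes "0 < a" "y < z"
  shows "tail_ratio a y < tail_ratio a z"
proof -
  define L where "L = exp (a * z - a\<^sup>2 / 2)"
  have "(L * Phi_bar z) * (Phi_bar y - Phi_bar z) \<le> Phi_bar (z - a) * (Phi_bar y - Phi_bar z)"
    using Phi_bar_shift_ge[of a z] assms by (intro mult_right_mono) (auto simp: L_def)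
  moreover have "(Phi_bar (y - a) - Phi_bar (z - a)) * Phi_bar z
      < (L * (Phi_bar y - Phi_bar z)) * Phi_bar z"
    using Phi_bar_shift_diff_less[OF assms] Phi_bar_pos
    by (intro mult_strict_right_mono) (auto simp: L_def)
  ultimately have "Phi_bar (y - a) * Phi_bar z < Phi_bar (z - a) * Phi_bar y"
    by (simp add: algebra_simps)
  thus ?thesis
    using Phi_bar_pos[of y] Phi_bar_pos[of z] by (simp add: tail_ratio_def field_simps)
qed

lemma tendsto_tail_ratio_at_bot: "(tail_ratio a \<longlongrightarrow> 1) at_bot"
proof -
  have "filterlim (\<lambda>z. z - a) at_bot at_bot"
    unfolding filterlim_at_bot eventually_at_bot_linorder by (metis add.commute diff_le_eq)
  hence "((\<lambda>z. Phi_bar (z - a) / Phi_bar z) \<longlongrightarrow> 1 / 1) at_bot"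
    by (intro tendsto_divide tendsto_Phi_bar_at_bot filterlim_compose[OF tendsto_Phi_bar_at_bot]) auto
  thus ?thesis by (simp add: tail_ratio_def[abs_def])
qed

lemma isCont_tail_ratio: "isCont (tail_ratio a) z"
  unfolding tail_ratio_def[abs_def] using Phi_bar_pos[of z]
  by (intro continuous_intros isCont_Phi_bar isCont_o2[OF _ isCont_Phi_bar]) auto

lemma tail_ratio_surj:
  assumes "0 < a" "1 < r"
  shows "\<exists>z. tail_ratio a z = r"
proof -
  obtain y where ratio_less: "tail_ratio a y < r"
    using order_tendstoD(2)[OF tendsto_tail_ratio_at_bot assms(2)]
      eventually_happens' trivial_limit_at_bot_linorder by blast
  define z where "z = (ln r + a\<^sup>2 / 2) / a"
  have ratio_ge: "r \<le> tail_ratio a z"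
    using tail_ratio_ge[of a z] assms by (simp add: z_def)
  have "y \<le> z"
    using tail_ratio_strict_mono[of a z y] ratio_less ratio_ge assms by fastforce
  thus ?thesis
    using IVT[of "tail_ratio a" y r z] ratio_less ratio_ge isCont_tail_ratio by auto
qed

subsection \<open>The p-value distribution of a two-component Gaussian mixture\<close>

definition mixture_cdf :: "real \<Rightarrow> real \<Rightarrow> real \<Rightarrow> real" where
  "mixture_cdf p a t = (1 - p) * t + p * Phi_bar (inv Phi_bar t - a)"

definition mixture_crossing :: "real \<Rightarrow> real \<Rightarrow> real \<Rightarrow> real" where
  "mixture_crossing p a y = (THE t. 0 < t \<and> t < 1 \<and> mixture_cdf p a t = y * t)"

lemma mixture_cdf_eq_tail_ratio:
  "0 < t \<Longrightarrow> t < 1 \<Longrightarrow> mixture_cdf p a t = (1 - p + p * tail_ratio a (inv Phi_bar t)) * t"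
  by (simp add: mixture_cdf_def tail_ratio_def Phi_bar_inv ring_distribs)

lemma mixture_cdf_div_strict_antimono:
  assumes "0 < p" "0 < a" "0 < s" "s < t" "t < 1"
  shows "mixture_cdf p a t / t < mixture_cdf p a s / s"
proof -
  have "tail_ratio a (inv Phi_bar t) < tail_ratio a (inv Phi_bar s)"
    using assms by (intro tail_ratio_strict_mono inv_Phi_bar_less)
  thus ?thesis using assms by (simp add: mixture_cdf_eq_tail_ratio)
qed

lemma ex1_mixture_crossing:
  assumes "0 < p" "0 < a" "1 < y"
  shows "\<exists>!t. 0 < t \<and> t < 1 \<and> mixture_cdf p a t = y * t"
proof -
  obtain z where ratio: "tail_ratio a z = 1 + (y - 1) / p"
    using tail_ratio_surj[of a "1 + (y - 1) / p"] assms by auto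
  have crossing: "mixture_cdf p a (Phi_bar z) = y * Phi_bar z"
    using assms by (simp add: mixture_cdf_eq_tail_ratio Phi_bar_pos Phi_bar_less_1 ratio field_simps)
  show ?thesis
  proof (rule ex1I[of _ "Phi_bar z"])
    show "0 < Phi_bar z \<and> Phi_bar z < 1 \<and> mixture_cdf p a (Phi_bar z) = y * Phi_bar z"
      using crossing Phi_bar_pos Phi_bar_less_1 by blast
    have slope: "mixture_cdf p a (Phi_bar z) / Phi_bar z = y"
      using crossing Phi_bar_pos[of z] by simp
    fix t assume solution: "0 < t \<and> t < 1 \<and> mixture_cdf p a t = y * t"
    hence "mixture_cdf p a t / t = y" by auto
    thus "t = Phi_bar z"
      using mixture_cdf_div_strict_antimono[OF assms(1,2), of t "Phi_bar z"]
        mixture_cdf_div_strict_antimono[OF assms(1,2), of "Phi_bar z" t]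
        slope solution Phi_bar_pos[of z] Phi_bar_less_1[of z]
      by fastforce
  qed
qed

lemma
  assumes "0 < p" "0 < a" "1 < y"
  shows mixture_crossing_pos: "0 < mixture_crossing p a y"
    and mixture_crossing_less_1: "mixture_crossing p a y < 1"
    and mixture_cdf_mixture_crossing:
      "mixture_cdf p a (mixture_crossing p a y) = y * mixture_crossing p a y"
  using theI'[OF ex1_mixture_crossing[OF assms]] by (simp_all add: mixture_crossing_def)

lemma mixture_crossing_antimono:
  assumes "0 < p" "0 < a" "1 < x" "x \<le> y"
  shows "mixture_crossing p a y \<le> mixture_crossing p a x"
proof (rule ccontr)
  assume greater: "\<not> ?thesis"
  have slope: "mixture_cdf p a (mixture_crossing p a z) / mixture_crossing p a z = z"
    if "1 < z" for z
    using mixture_cdf_mixture_crossing[of p a z] mixture_crossing_pos[of p a z] assms(1,2) that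
    by simp
  have "mixture_cdf p a (mixture_crossing p a y) / mixture_crossing p a y
      < mixture_cdf p a (mixture_crossing p a x) / mixture_crossing p a x"
    using greater assms
    by (intro mixture_cdf_div_strict_antimono mixture_crossing_pos mixture_crossing_less_1) auto
  thus False using slope[of x] slope[of y] assms by simp
qed

lemma mixture_crossing_le:
  assumes "0 < p" "0 < a" "1 < y"
  shows "mixture_crossing p a y \<le> p / (y - 1)"
proof -
  define t where "t = mixture_crossing p a y"
  have "y * t = (1 - p) * t + p * Phi_bar (inv Phi_bar t - a)"
    using mixture_cdf_mixture_crossing[OF assms] by (simp add: t_def mixture_cdf_def)
  moreover have "p * Phi_bar (inv Phi_bar t - a) \<le> p * 1"
    using assms by (intro mult_left_mono less_imp_le[OF Phi_bar_less_1]) auto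
  moreover have "0 < p * t" using mixture_crossing_pos[OF assms] assms by (simp add: t_def)
  ultimately have "(y - 1) * t \<le> p" by (simp add: algebra_simps)
  thus ?thesis using assms by (simp add: t_def pos_le_divide_eq mult.commute)
qed

text \<open>
  By the condition on \<open>w\<close>, the quantile of the crossing exceeds the shift \<open>a\<close> by at most \<open>w\<close>.
\<close>

lemma mixture_crossing_ge:
  assumes "0 < p" "p \<le> 1" "0 < a" "1 < y" and w_ge: "y \<le> p * exp (a * w + a\<^sup>2 / 2)"
  shows "p * Phi_bar w / y \<le> mixture_crossing p a y"
proof -
  define t where "t = mixture_crossing p a y"
  define z where "z = inv Phi_bar t"
  have crossing: "0 < t" "t < 1" "mixture_cdf p a t = y * t"
    using assms
    by (simp_all add: t_def mixture_crossing_pos mixture_crossing_less_1 mixture_cdf_mixture_crossing)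
  have "1 - p + p * tail_ratio a z = y"
    using mixture_cdf_eq_tail_ratio[OF crossing(1,2), of p a] crossing(1,3) by (auto simp: z_def)
  hence ratio: "p * tail_ratio a z \<le> y" using assms by linarith
  have "z \<le> a + w"
  proof (rule ccontr)
    assume "\<not> z \<le> a + w"
    hence "a * (a + w) < a * z" using assms by simp
    hence "p * exp (a * w + a\<^sup>2 / 2) < p * exp (a * z - a\<^sup>2 / 2)"
      using assms by (simp add: power2_eq_square algebra_simps)
    also have "\<dots> \<le> p * tail_ratio a z"
      using assms by (intro mult_left_mono tail_ratio_ge) auto
    finally show False using ratio w_ge by linarith
  qed
  hence "p * Phi_bar w \<le> p * Phi_bar (z - a)" using assms by (intro mult_left_mono) auto
  also have "\<dots> \<le> mixture_cdf p a t" using assms crossing(1) by (simp add: mixture_cdf_def z_def)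
  also have "\<dots> = y * t" by (rule crossing(3))
  finally show ?thesis using assms by (simp add: t_def divide_le_eq mult.commute)
qed

subsection \<open>Independence and Chernoff bounds\<close>

lemma indep_vars_PiM_components:
  assumes "\<And>i. i \<in> I \<Longrightarrow> prob_space (M i)"
  shows "prob_space.indep_vars (PiM I M) M (\<lambda>i x. x i) I"
proof -
  interpret prob_space "PiM I M" using assms by (rule prob_space_PiM)
  show ?thesis
  proof (cases "I = {}")
    case True
    show ?thesis unfolding indep_vars_def indep_sets_def by (simp add: True)
  next
    case False
    have "distr (PiM I M) (PiM I M) (\<lambda>x. \<lambda>i\<in>I. x i) = distr (PiM I M) (PiM I M) (\<lambda>x. x)"
      by (intro distr_cong) (auto simp: space_PiM)
    also have "\<dots> = PiM I (\<lambda>i. distr (PiM I M) (M i) (\<lambda>x. x i))"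
      using assms by (simp add: distr_PiM_component cong: PiM_cong)
    finally show ?thesis
      using False by (subst indep_vars_iff_distr_eq_PiM') auto
  qed
qed

lemma sum_exp_tail_le:
  fixes r K :: real
  assumes "0 < r" "finite A" "\<And>k. k \<in> A \<Longrightarrow> K \<le> real k"
  shows "(\<Sum>k\<in>A. exp (- (r * real k))) \<le> (1 + 1 / r) * exp (- (r * K))"
proof -
  define n where "n = nat \<lceil>K\<rceil>"
  define q where "q = exp (- r)"
  have n_le: "n \<le> k" if "k \<in> A" for k
    using assms(3)[OF that] unfolding n_def by linarith
  have q_bounds: "0 < q" "q < 1" using assms by (simp_all add: q_def)
  have "(\<Sum>k\<in>A. exp (- (r * real k))) = (\<Sum>k\<in>A. exp (- (r * real n)) * q ^ (k - n))"
  proof (intro sum.cong refl)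
    fix k assume "k \<in> A"
    thus "exp (- (r * real k)) = exp (- (r * real n)) * q ^ (k - n)"
      using n_le by (simp add: q_def of_nat_diff algebra_simps flip: exp_of_nat_mult exp_add)
  qed
  also have "\<dots> = exp (- (r * real n)) * (\<Sum>j\<in>(\<lambda>k. k - n) ` A. q ^ j)"
    using n_le by (subst sum.reindex) (auto simp: inj_on_def sum_distrib_left dest!: n_le)
  also have "\<dots> \<le> exp (- (r * real n)) * (\<Sum>j. q ^ j)"
    using assms q_bounds by (intro mult_left_mono sum_le_suminf summable_geometric) auto
  also have "(\<Sum>j. q ^ j) = 1 / (1 - q)"
    using q_bounds by (intro suminf_geometric) auto
  also have "exp (- (r * real n)) * (1 / (1 - q)) \<le> exp (- (r * K)) * (1 + 1 / r)"
  proof (intro mult_mono)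
    have "K \<le> real n" unfolding n_def by linarith
    thus "exp (- (r * real n)) \<le> exp (- (r * K))" using assms by simp
    have "1 + r \<le> exp r" by (rule exp_ge_add_one_self)
    hence "q \<le> 1 / (1 + r)" using assms by (simp add: q_def exp_minus field_simps)
    hence "r / (1 + r) \<le> 1 - q" using assms by (simp add: field_simps)
    thus "1 / (1 - q) \<le> 1 + 1 / r" using assms q_bounds by (simp add: field_simps)
  qed (use q_bounds in auto)
  finally show ?thesis by (simp add: mult.commute)
qed

lemma (in prob_space) prob_conj_ge:
  assumes [measurable]: "Measurable.pred M P" "Measurable.pred M Q"
  shows "1 - prob {x \<in> space M. \<not> P x} - prob {x \<in> space M. \<not> Q x} \<le> prob {x \<in> space M. P x \<and> Q x}"
proof -
  have "1 - prob {x \<in> space M. P x \<and> Q x} = prob {x \<in> space M. \<not> (P x \<and> Q x)}"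
    by (subst prob_neg) auto
  also have "{x \<in> space M. \<not> (P x \<and> Q x)} = {x \<in> space M. \<not> P x} \<union> {x \<in> space M. \<not> Q x}"
    by auto
  also have "prob \<dots> \<le> prob {x \<in> space M. \<not> P x} + prob {x \<in> space M. \<not> Q x}"
    by (intro measure_Un_le) auto
  finally show ?thesis by linarith
qed

lemma powr_le_affine:
  fixes u x :: real
  assumes "0 < u" "0 \<le> x" "x \<le> 1"
  shows "u powr x \<le> 1 + (u - 1) * x"
  using convex_onD[OF exp_convex assms(2,3), of 0 "ln u"] assms(1)
  by (simp add: powr_def algebra_simps)

text \<open>The large deviation rate function of the Poisson distribution with mean 1.\<close>

definition chernoff_rate :: "real \<Rightarrow> real" where
  "chernoff_rate u = u * ln u - u + 1"

lemma chernoff_rate_pos: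
  assumes "0 < u" "u \<noteq> 1"
  shows "0 < chernoff_rate u"
proof -
  have "u * (ln 1 - ln u) < u * ((1 - u) / u)"
    using assms by (intro mult_strict_left_mono ln_diff_less) auto
  thus ?thesis using assms by (simp add: chernoff_rate_def)
qed

locale indep_unit_interval_random_variables =
  indep_interval_bounded_random_variables M I X "\<lambda>_. 0" "\<lambda>_. 1"
  for M :: "'a measure" and I :: "'b set" and X :: "'b \<Rightarrow> 'a \<Rightarrow> real"
begin

lemma integrable_powr:
  assumes "i \<in> I" "0 < u"
  shows "integrable M (\<lambda>x. u powr X i x)"
proof (rule integrable_const_bound[where B = "max 1 u"])
  show "AE x in M. norm (u powr X i x) \<le> max 1 u"
    using AE_in_interval[OF assms(1)]
  proof eventually_elim
    case (elim x)
    have "u powr X i x \<le> max 1 u powr X i x" using elim assms by (intro powr_mono2) auto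
    also have "\<dots> \<le> max 1 u powr 1" using elim by (intro powr_mono) auto
    finally show ?case by simp
  qed
qed (use assms in measurable)

lemma expectation_powr_le:
  assumes "i \<in> I" "0 < u"
  shows "expectation (\<lambda>x. u powr X i x) \<le> exp ((u - 1) * expectation (X i))"
proof -
  interpret X: interval_bounded_random_variable M "X i" 0 1 using assms(1) ..
  have affine: "integrable M (\<lambda>x. 1 + (u - 1) * X i x)" using X.integrable by simp
  have "AE x in M. u powr X i x \<le> 1 + (u - 1) * X i x"
    using AE_in_interval[OF assms(1)] by eventually_elim (use assms in \<open>auto intro: powr_le_affine\<close>)
  hence "expectation (\<lambda>x. u powr X i x) \<le> expectation (\<lambda>x. 1 + (u - 1) * X i x)"
    using assms by (intro integral_mono_AE integrable_powr affine)
  also have "\<dots> = 1 + (u - 1) * expectation (X i)"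
    using X.integrable by (simp add: prob_space)
  also have "\<dots> \<le> exp ((u - 1) * expectation (X i))" by (rule exp_ge_add_one_self)
  finally show ?thesis .
qed

definition mean :: real where
  "mean = (\<Sum>i\<in>I. expectation (X i))"

lemma prob_powr_sum_ge_le:
  assumes "0 < u" "0 < w"
  shows "prob {x \<in> space M. w \<le> u powr (\<Sum>i\<in>I. X i x)} \<le> exp ((u - 1) * mean) / w"
proof -
  have indep_powr: "indep_vars (\<lambda>_. borel) (\<lambda>i x. u powr X i x) I"
    by (rule indep_vars_compose2[OF indep]) measurable
  have powr_sum_eq: "u powr (\<Sum>i\<in>I. X i x) = (\<Prod>i\<in>I. u powr X i x)" for x
    using assms fin by (simp add: powr_sum)
  have "prob {x \<in> space M. w \<le> u powr (\<Sum>i\<in>I. X i x)}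
      \<le> expectation (\<lambda>x. u powr (\<Sum>i\<in>I. X i x)) / w"
    unfolding powr_sum_eq using assms fin indep_powr
    by (intro integral_Markov_inequality_measure[where A = "{}"] indep_vars_integrable integrable_powr)
       (auto intro!: prod_nonneg)
  also have "expectation (\<lambda>x. u powr (\<Sum>i\<in>I. X i x)) = (\<Prod>i\<in>I. expectation (\<lambda>x. u powr X i x))"
    unfolding powr_sum_eq using assms fin indep_powr
    by (intro indep_vars_lebesgue_integral integrable_powr)
  also have "\<dots> \<le> (\<Prod>i\<in>I. exp ((u - 1) * expectation (X i)))"
    using assms by (intro prod_mono conjI expectation_powr_le integral_nonneg) auto
  also have "\<dots> = exp ((u - 1) * mean)"
    using fin by (simp add: mean_def sum_distrib_left exp_sum)
  finally show ?thesis using assms by (simp add: divide_right_mono)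
qed

lemma chernoff_lower_tail:
  assumes "0 < u" "u \<le> 1"
  shows "prob {x \<in> space M. (\<Sum>i\<in>I. X i x) \<le> u * mean} \<le> exp (- (chernoff_rate u * mean))"
proof -
  have "prob {x \<in> space M. (\<Sum>i\<in>I. X i x) \<le> u * mean}
      \<le> prob {x \<in> space M. u powr (u * mean) \<le> u powr (\<Sum>i\<in>I. X i x)}"
    using assms by (intro finite_measure_mono) (auto intro: powr_mono')
  also have "\<dots> \<le> exp ((u - 1) * mean) / u powr (u * mean)"
    using assms by (intro prob_powr_sum_ge_le) auto
  also have "\<dots> = exp (- (chernoff_rate u * mean))"
    using assms by (simp add: powr_def chernoff_rate_def algebra_simps flip: exp_diff)
  finally show ?thesis .
qed

lemma chernoff_upper_tail:
  assumes "1 \<le> u" "mean \<le> v"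
  shows "prob {x \<in> space M. u * v \<le> (\<Sum>i\<in>I. X i x)} \<le> exp (- (chernoff_rate u * v))"
proof -
  have "prob {x \<in> space M. u * v \<le> (\<Sum>i\<in>I. X i x)}
      \<le> prob {x \<in> space M. u powr (u * v) \<le> u powr (\<Sum>i\<in>I. X i x)}"
    using assms by (intro finite_measure_mono) (auto intro: powr_mono)
  also have "\<dots> \<le> exp ((u - 1) * mean) / u powr (u * v)"
    using assms by (intro prob_powr_sum_ge_le) auto
  also have "\<dots> \<le> exp ((u - 1) * v) / u powr (u * v)"
    using assms by (intro divide_right_mono) (auto intro: mult_left_mono)
  also have "\<dots> = exp (- (chernoff_rate u * v))"
    using assms by (simp add: powr_def chernoff_rate_def algebra_simps flip: exp_diff)
  finally show ?thesis .
qed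

end

subsection \<open>Rejections of the Benjamini--Hochberg procedure\<close>

lemma sorted_nth_le_iff:
  fixes s :: "'a :: linorder"
  assumes "sorted ys" "j < length ys"
  shows "ys ! j \<le> s \<longleftrightarrow> j < length (filter (\<lambda>y. y \<le> s) ys)"
  using assms
proof (induction ys arbitrary: j)
  case (Cons y ys)
  show ?case
  proof (cases "y \<le> s")
    case True
    then show ?thesis using Cons by (cases j) auto
  next
    case False
    hence above: "\<forall>x\<in>set (y # ys). \<not> x \<le> s" using Cons.prems(1) by auto
    hence "filter (\<lambda>y. y \<le> s) (y # ys) = []" by (simp only: filter_empty_conv)
    moreover have "\<not> (y # ys) ! j \<le> s" using above nth_mem[OF Cons.prems(2)] by blast
    ultimately show ?thesis by simp
  qed
qed simp

definition pvalue_count :: "nat \<Rightarrow> (nat \<Rightarrow> real) \<Rightarrow> real \<Rightarrow> nat" where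
  "pvalue_count m X t = card {i \<in> {1..m}. Phi_bar (X i) \<le> t}"

lemma pvalue_count_eq_sum:
  "real (pvalue_count m X t) = (\<Sum>i\<in>{1..m}. indicator {..t} (Phi_bar (X i)))"
proof -
  have "{1..m} \<inter> {i. Phi_bar (X i) \<le> t} = {i \<in> {1..m}. Phi_bar (X i) \<le> t}" by auto
  thus ?thesis by (simp add: pvalue_count_def indicator_def sum.If_cases)
qed

lemma pvalue_count_le: "pvalue_count m X t \<le> m"
  unfolding pvalue_count_def by (rule order.trans[OF card_mono[of "{1..m}"]]) auto

lemma pvalue_count_mono: "s \<le> t \<Longrightarrow> pvalue_count m X s \<le> pvalue_count m X t"
  unfolding pvalue_count_def by (intro card_mono) auto

lemma ordered_pvalue_le_iff:
  assumes "1 \<le> k" "k \<le> m"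
  shows "ordered_pvalue m X k \<le> t \<longleftrightarrow> k \<le> pvalue_count m X t"
proof -
  have "ordered_pvalue m X k \<le> t
      \<longleftrightarrow> k - 1 < length (filter (\<lambda>y. y \<le> t) (map (\<lambda>i. Phi_bar (X i)) [1..<Suc m]))"
    unfolding ordered_pvalue_def using assms
    by (subst sorted_nth_le_iff) (auto simp: filter_sort simp del: upt_Suc)
  also have "length (filter (\<lambda>y. y \<le> t) (map (\<lambda>i. Phi_bar (X i)) [1..<Suc m]))
      = card (set (filter (\<lambda>i. Phi_bar (X i) \<le> t) [1..<Suc m]))"
    by (subst distinct_card) (auto simp: filter_map o_def simp del: upt_Suc)
  also have "set (filter (\<lambda>i. Phi_bar (X i) \<le> t) [1..<Suc m]) = {i \<in> {1..m}. Phi_bar (X i) \<le> t}"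
    by auto
  finally show ?thesis using assms by (auto simp: pvalue_count_def)
qed

lemma bh_rejections_eq:
  "bh_rejections \<alpha> m X = Max (insert 0 {k \<in> {1..m}. k \<le> pvalue_count m X (\<alpha> * real k / real m)})"
proof -
  have "real m * ordered_pvalue m X k / real k \<le> \<alpha> \<longleftrightarrow> k \<le> pvalue_count m X (\<alpha> * real k / real m)"
    if "k \<in> {1..m}" for k
  proof -
    have "real m * ordered_pvalue m X k / real k \<le> \<alpha> \<longleftrightarrow> ordered_pvalue m X k \<le> \<alpha> * real k / real m"
      using that by (simp add: field_simps)
    thus ?thesis using that by (simp add: ordered_pvalue_le_iff)
  qed
  hence "{k \<in> {1..m}. real m * ordered_pvalue m X k / real k \<le> \<alpha>}
      = {k \<in> {1..m}. k \<le> pvalue_count m X (\<alpha> * real k / real m)}"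
    by blast
  thus ?thesis unfolding bh_rejections_def by simp
qed

lemma bh_rejections_ge:
  "k \<le> m \<Longrightarrow> k \<le> pvalue_count m X (\<alpha> * real k / real m) \<Longrightarrow> k \<le> bh_rejections \<alpha> m X"
  unfolding bh_rejections_eq by (cases "k = 0") (auto intro: Max_ge)

abbreviation bh_threshold :: "real \<Rightarrow> nat \<Rightarrow> (nat \<Rightarrow> real) \<Rightarrow> real" where
  "bh_threshold \<alpha> m X \<equiv> \<alpha> * real (bh_rejections \<alpha> m X) / real m"

lemma bh_rejections_le: "bh_rejections \<alpha> m X \<le> m"
  and bh_rejections_le_pvalue_count:
    "bh_rejections \<alpha> m X \<le> pvalue_count m X (bh_threshold \<alpha> m X)"
proof -
  let ?A = "{k \<in> {1..m}. k \<le> pvalue_count m X (\<alpha> * real k / real m)}"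
  have "Max (insert 0 ?A) \<in> insert 0 ?A" by (rule Max_in) simp_all
  hence "bh_rejections \<alpha> m X \<in> insert 0 ?A" unfolding bh_rejections_eq .
  thus "bh_rejections \<alpha> m X \<le> m"
    and "bh_rejections \<alpha> m X \<le> pvalue_count m X (bh_threshold \<alpha> m X)"
    by auto
qed

lemma bh_threshold_ge:
  assumes "0 < \<alpha>" "0 < m" "real m * t / \<alpha> \<le> real (pvalue_count m X t)"
  shows "t \<le> bh_threshold \<alpha> m X"
proof -
  define k where "k = pvalue_count m X t"
  have t_le: "t \<le> \<alpha> * real k / real m" using assms by (simp add: k_def field_simps)
  have "k \<le> bh_rejections \<alpha> m X"
    using pvalue_count_le pvalue_count_mono[OF t_le] by (intro bh_rejections_ge) (auto simp: k_def)
  hence "\<alpha> * real k / real m \<le> bh_threshold \<alpha> m X"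
    using assms by (intro divide_right_mono mult_left_mono) auto
  with t_le show ?thesis by (rule order.trans)
qed

subsection \<open>Order of magnitude of the thresholds\<close>

lemma lesssimI: "0 < C \<Longrightarrow> (\<forall>\<^sub>F m in sequentially. u m \<le> C * v m) \<Longrightarrow> lesssim u v"
  unfolding lesssim_def by blast

text \<open>
  Chosen so that \<open>mixture_crossing_ge\<close> eventually applies to \<open>w = quantile_excess \<alpha> b c \<beta>\<close>. It is
  free of \<open>c\<close> if \<open>\<beta> > 0\<close>, which makes the deviation rate uniform in \<open>c\<close>.
\<close>

definition quantile_excess :: "real \<Rightarrow> real \<Rightarrow> real \<Rightarrow> real \<Rightarrow> real" where
  "quantile_excess \<alpha> b c \<beta> = (if 0 < \<beta> then 0 else ln (4 / (\<alpha> * c)) / b - b / 2)"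

text \<open>
  The bound \<open>t_star \<ge> \<alpha> / 2 * Phi_bar (quantile_excess \<alpha> b c \<beta>) * m1 / m\<close> turns the exponent
  \<open>m * t_star / (6 * \<alpha>)\<close> into \<open>Phi_bar (quantile_excess \<alpha> b c \<beta>) * m1 / 12\<close>. Half of it is spent on
  absorbing the constant in front of the exponential.
\<close>

definition deviation_rate :: "real \<Rightarrow> real \<Rightarrow> real \<Rightarrow> real \<Rightarrow> real" where
  "deviation_rate \<alpha> b c \<beta> = Phi_bar (quantile_excess \<alpha> b c \<beta>) / 24"

lemma deviation_rate_pos: "0 < deviation_rate \<alpha> b c \<beta>"
  by (simp add: deviation_rate_def Phi_bar_pos)

lemma deviation_rate_constant_on: "0 < \<beta> \<Longrightarrow> (\<lambda>c. deviation_rate \<alpha> b c \<beta>) constant_on S"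
  unfolding constant_on_def
  by (intro exI[of _ "Phi_bar 0 / 24"]) (simp add: deviation_rate_def quantile_excess_def)

locale bh_sparse_gaussian =
  fixes \<alpha> b c \<beta> :: real
  assumes alpha_bounds: "0 < \<alpha>" "\<alpha> < 1" and b_pos: "0 < b" and c_bounds: "0 < c" "c < 1"
    and beta_bounds: "0 \<le> \<beta>" "\<beta> < 1"
begin

abbreviation signal_fraction :: "nat \<Rightarrow> real" where
  "signal_fraction m \<equiv> real (m1 c \<beta> m) / real m"

lemma m1_pos_imp_pos: "0 < m1 c \<beta> m \<Longrightarrow> 0 < m"
  using m1_le[of c \<beta> m] c_bounds beta_bounds by linarith

lemma signal_fraction_le_1: "signal_fraction m \<le> 1"
  using m1_le[of c \<beta> m] c_bounds beta_bounds by (cases "m = 0") auto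

lemma mu_pos: "0 < m \<Longrightarrow> 0 < mu b \<beta> m"
  unfolding mu_def using b_pos beta_bounds by (intro add_nonneg_pos) auto

lemma G_eq_mixture_cdf: "0 < m \<Longrightarrow> G b c \<beta> m = mixture_cdf (signal_fraction m) (mu b \<beta> m)"
  using m1_le[of c \<beta> m] c_bounds beta_bounds
  by (intro ext) (simp add: G_def mixture_cdf_def m0_def of_nat_diff diff_divide_distrib)

lemma G_div_antimono:
  assumes "0 < m1 c \<beta> m" "0 < s" "s \<le> t" "t < 1"
  shows "G b c \<beta> m t / t \<le> G b c \<beta> m s / s"
proof (cases "s = t")
  case False
  have "0 < m" using assms(1) by (rule m1_pos_imp_pos)
  thus ?thesis
    using False assms mixture_cdf_div_strict_antimono[of "signal_fraction m" "mu b \<beta> m" s t] mu_pos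
    by (simp add: G_eq_mixture_cdf)
qed simp

lemma t_star_eq_mixture_crossing:
  "0 < m \<Longrightarrow> t_star \<alpha> b c \<beta> m = mixture_crossing (signal_fraction m) (mu b \<beta> m) (2 / \<alpha>)"
  by (simp add: t_star_def mixture_crossing_def G_eq_mixture_cdf)

lemma t_sharp_eq_mixture_crossing:
  "0 < m \<Longrightarrow> t_sharp \<alpha> b c \<beta> m = mixture_crossing (signal_fraction m) (mu b \<beta> m) (1 / (2 * \<alpha>))"
  by (simp add: t_sharp_def mixture_crossing_def G_eq_mixture_cdf)

lemma
  assumes "0 < m1 c \<beta> m"
  shows t_star_pos: "0 < t_star \<alpha> b c \<beta> m"
    and t_star_less_1: "t_star \<alpha> b c \<beta> m < 1"
    and G_t_star: "G b c \<beta> m (t_star \<alpha> b c \<beta> m) = 2 / \<alpha> * t_star \<alpha> b c \<beta> m"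
proof -
  have m_pos: "0 < m" using assms by (rule m1_pos_imp_pos)
  hence params: "0 < signal_fraction m" "0 < mu b \<beta> m" "1 < 2 / \<alpha>"
    using assms mu_pos alpha_bounds by simp_all
  show "0 < t_star \<alpha> b c \<beta> m" "t_star \<alpha> b c \<beta> m < 1"
    "G b c \<beta> m (t_star \<alpha> b c \<beta> m) = 2 / \<alpha> * t_star \<alpha> b c \<beta> m"
    unfolding t_star_eq_mixture_crossing[OF m_pos] G_eq_mixture_cdf[OF m_pos]
    using params by (rule mixture_crossing_pos mixture_crossing_less_1 mixture_cdf_mixture_crossing)+
qed

lemma
  assumes "0 < m1 c \<beta> m" "\<alpha> < 1/2"
  shows t_sharp_pos: "0 < t_sharp \<alpha> b c \<beta> m"
    and G_t_sharp: "G b c \<beta> m (t_sharp \<alpha> b c \<beta> m) = 1 / (2 * \<alpha>) * t_sharp \<alpha> b c \<beta> m"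
proof -
  have m_pos: "0 < m" using assms(1) by (rule m1_pos_imp_pos)
  hence params: "0 < signal_fraction m" "0 < mu b \<beta> m" "1 < 1 / (2 * \<alpha>)"
    using assms mu_pos alpha_bounds by simp_all
  show "0 < t_sharp \<alpha> b c \<beta> m"
    "G b c \<beta> m (t_sharp \<alpha> b c \<beta> m) = 1 / (2 * \<alpha>) * t_sharp \<alpha> b c \<beta> m"
    unfolding t_sharp_eq_mixture_crossing[OF m_pos] G_eq_mixture_cdf[OF m_pos]
    using params by (rule mixture_crossing_pos mixture_cdf_mixture_crossing)+
qed

lemma t_star_le_t_sharp:
  assumes "0 < m1 c \<beta> m" "\<alpha> < 1/2"
  shows "t_star \<alpha> b c \<beta> m \<le> t_sharp \<alpha> b c \<beta> m"
proof -
  have m_pos: "0 < m" using assms(1) by (rule m1_pos_imp_pos)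
  have "mixture_crossing (signal_fraction m) (mu b \<beta> m) (2 / \<alpha>)
      \<le> mixture_crossing (signal_fraction m) (mu b \<beta> m) (1 / (2 * \<alpha>))"
    using assms m_pos mu_pos alpha_bounds by (intro mixture_crossing_antimono) (auto simp: field_simps)
  thus ?thesis using m_pos by (simp add: t_star_eq_mixture_crossing t_sharp_eq_mixture_crossing)
qed

lemma filterlim_m1_at_top: "filterlim (\<lambda>m. real (m1 c \<beta> m)) at_top sequentially"
proof (rule filterlim_at_top_mono)
  show "filterlim (\<lambda>m. c * real m powr (1 - \<beta>) - 1) at_top sequentially"
    using c_bounds(1) beta_bounds(2) by real_asymp
  show "\<forall>\<^sub>F m in sequentially. c * real m powr (1 - \<beta>) - 1 \<le> real (m1 c \<beta> m)"
    by (intro always_eventually allI) (unfold m1_def, linarith)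
qed

lemma eventually_m1_pos: "\<forall>\<^sub>F m in sequentially. 0 < m1 c \<beta> m"
proof -
  have "\<forall>\<^sub>F m in sequentially. 0 < real (m1 c \<beta> m)"
    using filterlim_m1_at_top unfolding filterlim_at_top_dense by blast
  thus ?thesis by simp
qed

lemma eventually_signal_fraction_ge:
  "\<forall>\<^sub>F m in sequentially. c / 2 * real m powr (- \<beta>) \<le> signal_fraction m"
proof -
  have "\<forall>\<^sub>F m in sequentially. 2 \<le> c * real m powr (1 - \<beta>)"
    using c_bounds(1) beta_bounds(2) by real_asymp
  thus ?thesis using eventually_gt_at_top[of 0]
  proof eventually_elim
    case (elim m)
    have "c / 2 * real m powr (- \<beta>) = (c * real m powr (1 - \<beta>) / 2) / real m"
      using elim by (simp add: powr_diff powr_minus field_simps)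
    also have "c * real m powr (1 - \<beta>) / 2 \<le> real (m1 c \<beta> m)"
      using elim(1) unfolding m1_def by linarith
    finally show ?case by (simp add: divide_right_mono)
  qed
qed

lemma exp_mu_square_ge:
  assumes "0 < m"
  shows "real m powr \<beta> * exp (b * sqrt (2 * \<beta> * ln (real m))) \<le> exp ((mu b \<beta> m)\<^sup>2 / 2)"
proof -
  define s where "s = sqrt (2 * \<beta> * ln (real m))"
  have "s\<^sup>2 = 2 * \<beta> * ln (real m)" using assms beta_bounds by (simp add: s_def)
  hence "(mu b \<beta> m)\<^sup>2 / 2 = \<beta> * ln (real m) + b * s + b\<^sup>2 / 2"
    by (simp add: mu_def power2_sum flip: s_def)
  moreover have "real m powr \<beta> * exp (b * s) = exp (\<beta> * ln (real m) + b * s)"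
    using assms by (simp add: powr_def exp_add)
  ultimately show ?thesis by (simp add: s_def)
qed

lemma eventually_quantile_excess:
  "\<forall>\<^sub>F m in sequentially.
    2 / \<alpha> \<le> signal_fraction m * exp (mu b \<beta> m * quantile_excess \<alpha> b c \<beta> + (mu b \<beta> m)\<^sup>2 / 2)"
proof (cases "0 < \<beta>")
  case True
  have "\<forall>\<^sub>F m in sequentially. 2 / \<alpha> \<le> c / 2 * exp (b * sqrt (2 * \<beta> * ln (real m)))"
    using True b_pos c_bounds(1) by real_asymp
  with eventually_signal_fraction_ge eventually_gt_at_top[of 0] show ?thesis
  proof eventually_elim
    case (elim m)
    have "2 / \<alpha> \<le> c / 2 * exp (b * sqrt (2 * \<beta> * ln (real m)))" by (rule elim(3))
    also have "\<dots> = (c / 2 * real m powr (- \<beta>))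
        * (real m powr \<beta> * exp (b * sqrt (2 * \<beta> * ln (real m))))"
      using elim(2) by (simp add: powr_minus)
    also have "\<dots> \<le> signal_fraction m * exp ((mu b \<beta> m)\<^sup>2 / 2)"
      using elim exp_mu_square_ge by (intro mult_mono) auto
    finally show ?case using True by (simp add: quantile_excess_def)
  qed
next
  case False
  hence [simp]: "\<beta> = 0" using beta_bounds by simp
  from eventually_signal_fraction_ge eventually_gt_at_top[of 0] show ?thesis
  proof eventually_elim
    case (elim m)
    have "b * quantile_excess \<alpha> b c \<beta> + b\<^sup>2 / 2 = ln (4 / (\<alpha> * c))"
      using b_pos by (simp add: quantile_excess_def power2_eq_square right_diff_distrib)
    hence "c / 2 * exp (b * quantile_excess \<alpha> b c \<beta> + b\<^sup>2 / 2) = 2 / \<alpha>"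
      using alpha_bounds c_bounds by simp
    moreover have "c / 2 * exp (b * quantile_excess \<alpha> b c \<beta> + b\<^sup>2 / 2)
        \<le> signal_fraction m * exp (b * quantile_excess \<alpha> b c \<beta> + b\<^sup>2 / 2)"
      using elim by (intro mult_right_mono) auto
    ultimately show ?case by (simp add: mu_def)
  qed
qed

lemma eventually_t_star_ge:
  "\<forall>\<^sub>F m in sequentially. 12 * \<alpha> * deviation_rate \<alpha> b c \<beta> * signal_fraction m \<le> t_star \<alpha> b c \<beta> m"
  using eventually_m1_pos eventually_quantile_excess
proof eventually_elim
  case (elim m)
  have m_pos: "0 < m" using elim(1) by (rule m1_pos_imp_pos)
  have "signal_fraction m * Phi_bar (quantile_excess \<alpha> b c \<beta>) / (2 / \<alpha>) \<le> t_star \<alpha> b c \<beta> m"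
    unfolding t_star_eq_mixture_crossing[OF m_pos]
    using elim m_pos alpha_bounds mu_pos signal_fraction_le_1 by (intro mixture_crossing_ge) auto
  thus ?case by (simp add: deviation_rate_def mult_ac)
qed

lemma eventually_ex1_G_eq:
  assumes "1 < y"
  shows "\<forall>\<^sub>F m in sequentially. \<exists>!t. 0 < t \<and> t < 1 \<and> G b c \<beta> m t = y * t"
  using eventually_m1_pos
proof eventually_elim
  case (elim m)
  have m_pos: "0 < m" using elim by (rule m1_pos_imp_pos)
  show ?case
    using ex1_mixture_crossing[of "signal_fraction m" "mu b \<beta> m" y] elim m_pos mu_pos assms
    by (simp add: G_eq_mixture_cdf)
qed

lemma eventually_ex1_t_star:
  "\<forall>\<^sub>F m in sequentially. \<exists>!t. 0 < t \<and> t < 1 \<and> G b c \<beta> m t = 2 * t / \<alpha>"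
  using eventually_ex1_G_eq[of "2 / \<alpha>"] alpha_bounds by simp

lemma eventually_ex1_t_sharp:
  "\<alpha> < 1/2 \<Longrightarrow> \<forall>\<^sub>F m in sequentially. \<exists>!t. 0 < t \<and> t < 1 \<and> G b c \<beta> m t = 0.5 * t / \<alpha>"
  using eventually_ex1_G_eq[of "0.5 / \<alpha>"] alpha_bounds by simp

lemma eventually_t_star_le_t_sharp:
  "\<alpha> < 1/2 \<Longrightarrow> \<forall>\<^sub>F m in sequentially. t_star \<alpha> b c \<beta> m \<le> t_sharp \<alpha> b c \<beta> m"
  using eventually_m1_pos by eventually_elim (rule t_star_le_t_sharp)

lemma signal_fraction_lesssim_t_star: "lesssim signal_fraction (t_star \<alpha> b c \<beta>)"
proof (rule lesssimI)
  show "0 < 1 / (12 * \<alpha> * deviation_rate \<alpha> b c \<beta>)" using alpha_bounds deviation_rate_pos by simp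
  show "\<forall>\<^sub>F m in sequentially.
      signal_fraction m \<le> 1 / (12 * \<alpha> * deviation_rate \<alpha> b c \<beta>) * t_star \<alpha> b c \<beta> m"
    using eventually_t_star_ge
    by eventually_elim
      (use alpha_bounds deviation_rate_pos[of \<alpha> b c \<beta>] in \<open>simp add: pos_le_divide_eq mult.commute\<close>)
qed

lemma t_star_lesssim_signal_fraction: "lesssim (t_star \<alpha> b c \<beta>) signal_fraction"
proof (rule lesssimI)
  show "0 < 1 / (2 / \<alpha> - 1)" using alpha_bounds by (simp add: field_simps)
  show "\<forall>\<^sub>F m in sequentially. t_star \<alpha> b c \<beta> m \<le> 1 / (2 / \<alpha> - 1) * signal_fraction m"
    using eventually_m1_pos
  proof eventually_elim
    case (elim m)
    have m_pos: "0 < m" using elim by (rule m1_pos_imp_pos)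
    show ?case
      using mixture_crossing_le[of "signal_fraction m" "mu b \<beta> m" "2 / \<alpha>"]
        elim m_pos mu_pos alpha_bounds
      by (simp add: t_star_eq_mixture_crossing mult.commute)
  qed
qed

lemma t_sharp_lesssim_signal_fraction:
  assumes "\<alpha> < 1/2"
  shows "lesssim (t_sharp \<alpha> b c \<beta>) signal_fraction"
proof (rule lesssimI)
  show "0 < 1 / (1 / (2 * \<alpha>) - 1)" using alpha_bounds assms by (simp add: field_simps)
  show "\<forall>\<^sub>F m in sequentially. t_sharp \<alpha> b c \<beta> m \<le> 1 / (1 / (2 * \<alpha>) - 1) * signal_fraction m"
    using eventually_m1_pos
  proof eventually_elim
    case (elim m)
    have m_pos: "0 < m" using elim by (rule m1_pos_imp_pos)
    show ?case
      using mixture_crossing_le[of "signal_fraction m" "mu b \<beta> m" "1 / (2 * \<alpha>)"]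
        elim m_pos mu_pos alpha_bounds assms
      by (simp add: t_sharp_eq_mixture_crossing mult.commute)
  qed
qed

end

subsection \<open>Concentration of the rejection threshold\<close>

locale bh_sparse_gaussian_sample = bh_sparse_gaussian +
  fixes m :: nat and H0 :: "nat set"
  assumes m1_pos: "0 < m1 c \<beta> m" and null_set: "null_set c \<beta> m H0"
begin

lemma m_pos: "0 < m"
  using m1_pos by (rule m1_pos_imp_pos)

abbreviation mean_shift :: "nat \<Rightarrow> real" where
  "mean_shift i \<equiv> if i \<in> H0 then 0 else mu b \<beta> m"

abbreviation sample :: "(nat \<Rightarrow> real) measure" where
  "sample \<equiv> gauss_model b \<beta> m H0"

lemma sample_eq_PiM: "sample = PiM {1..m} (\<lambda>i. normal_law (mean_shift i))"
  by (simp add: gauss_model_def)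

sublocale prob_space sample
  unfolding sample_eq_PiM by (rule prob_space_PiM) (rule prob_space_normal_law)

lemma sets_sample [measurable_cong]: "sets sample = sets (PiM {1..m} (\<lambda>_. borel))"
  unfolding sample_eq_PiM by (intro sets_PiM_cong) simp_all

lemma measurable_pvalue_count [measurable]:
  "(\<lambda>X. pvalue_count m X t) \<in> measurable sample (count_space UNIV)"
proof -
  have "Measurable.pred sample (\<lambda>X. i \<in> {1..m} \<and> Phi_bar (X i) \<le> t)" for i
    by (cases "i \<in> {1..m}") (simp_all, measurable)
  thus ?thesis unfolding pvalue_count_def by (intro measurable_card) (simp add: pred_def)
qed

lemma measurable_bh_rejections [measurable]:
  "bh_rejections \<alpha>' m \<in> measurable sample (count_space UNIV)"
proof -
  have "insert 0 {k \<in> {1..m}. Q k} = {k. k = 0 \<or> k \<in> {1..m} \<and> Q k}" for Q :: "nat \<Rightarrow> bool" by auto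
  hence "bh_rejections \<alpha>' m =
      (\<lambda>X. Max {k. k = 0 \<or> k \<in> {1..m} \<and> k \<le> pvalue_count m X (\<alpha>' * real k / real m)})"
    by (intro ext) (simp only: bh_rejections_eq)
  moreover have "Measurable.pred sample
      (\<lambda>X. k = 0 \<or> k \<in> {1..m} \<and> k \<le> pvalue_count m X (\<alpha>' * real k / real m))" for k
    by measurable
  ultimately show ?thesis by (simp only: measurable_Max_nat)
qed

lemma indep_pvalue_indicators:
  "indep_unit_interval_random_variables sample {1..m} (\<lambda>i X. indicator {..t} (Phi_bar (X i)))"
proof unfold_locales
  have "indep_vars (\<lambda>i. normal_law (mean_shift i)) (\<lambda>i X. X i) {1..m}"
    unfolding sample_eq_PiM by (rule indep_vars_PiM_components) (rule prob_space_normal_law)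
  thus "indep_vars (\<lambda>_. borel) (\<lambda>i X. indicat_real {..t} (Phi_bar (X i))) {1..m}"
    by (rule indep_vars_compose2) measurable
qed (auto simp: indicator_def)

lemma expectation_pvalue_indicator:
  assumes "i \<in> {1..m}" "0 < t" "t < 1"
  shows "expectation (\<lambda>X. indicator {..t} (Phi_bar (X i))) = Phi_bar (inv Phi_bar t - mean_shift i)"
proof -
  have component: "distr sample (normal_law (mean_shift i)) (\<lambda>X. X i) = normal_law (mean_shift i)"
    unfolding sample_eq_PiM using assms(1) by (intro distr_PiM_component prob_space_normal_law)
  have "expectation (\<lambda>X. indicat_real {..t} (Phi_bar (X i)))
      = expectation (\<lambda>X. indicat_real {inv Phi_bar t..} (X i))"
    using assms by (simp add: indicator_def Phi_bar_le_iff_inv_le)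
  also have "\<dots>
      = (\<integral>x. indicat_real {inv Phi_bar t..} x \<partial>distr sample (normal_law (mean_shift i)) (\<lambda>X. X i))"
    using assms(1) by (subst integral_distr) (auto intro!: measurable_component_singleton)
  also have "\<dots> = Phi_bar (inv Phi_bar t - mean_shift i)"
    unfolding component by (simp add: measure_normal_law_atLeast)
  finally show ?thesis .
qed

lemma sum_expectation_pvalue_indicator:
  assumes "0 < t" "t < 1"
  shows "(\<Sum>i\<in>{1..m}. expectation (\<lambda>X. indicator {..t} (Phi_bar (X i)))) = real m * G b c \<beta> m t"
proof -
  have null_indices: "H0 \<subseteq> {1..m}" "card H0 = m0 c \<beta> m" using null_set by (auto simp: null_set_def)
  moreover have "m1 c \<beta> m \<le> m" using c_bounds beta_bounds by (intro m1_le) auto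
  ultimately have card_H1: "card ({1..m} - H0) = m1 c \<beta> m"
    by (simp add: card_Diff_subset finite_subset[OF null_indices(1)] m0_def)
  have "(\<Sum>i\<in>{1..m}. expectation (\<lambda>X. indicator {..t} (Phi_bar (X i))))
      = (\<Sum>i\<in>{1..m}. Phi_bar (inv Phi_bar t - mean_shift i))"
    using assms by (intro sum.cong expectation_pvalue_indicator) auto
  also have "\<dots> = (\<Sum>i\<in>{1..m} - H0. Phi_bar (inv Phi_bar t - mu b \<beta> m)) + (\<Sum>i\<in>H0. t)"
    using assms by (subst sum.subset_diff[OF null_indices(1)])
      (auto simp: Phi_bar_inv intro!: arg_cong2[where f = "(+)"] sum.cong)
  also have "\<dots> = real m * G b c \<beta> m t"
    using m_pos null_indices(2) card_H1 by (simp add: G_def field_simps)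
  finally show ?thesis .
qed

lemma prob_pvalue_count_le:
  assumes "0 < t" "t < 1" "0 < u" "u \<le> 1"
  shows "prob {X \<in> space sample. real (pvalue_count m X t) \<le> u * (real m * G b c \<beta> m t)}
    \<le> exp (- (chernoff_rate u * (real m * G b c \<beta> m t)))"
proof -
  interpret indep_unit_interval_random_variables sample "{1..m}"
    "\<lambda>i X. indicator {..t} (Phi_bar (X i))"
    by (rule indep_pvalue_indicators)
  have "mean = real m * G b c \<beta> m t"
    using assms by (simp only: mean_def sum_expectation_pvalue_indicator)
  thus ?thesis using chernoff_lower_tail[OF assms(3,4)] by (simp only: pvalue_count_eq_sum)
qed

lemma prob_pvalue_count_ge:
  assumes "0 < t" "t < 1" "1 \<le> u" "real m * G b c \<beta> m t \<le> v"
  shows "prob {X \<in> space sample. u * v \<le> real (pvalue_count m X t)} \<le> exp (- (chernoff_rate u * v))"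
proof -
  interpret indep_unit_interval_random_variables sample "{1..m}"
    "\<lambda>i X. indicator {..t} (Phi_bar (X i))"
    by (rule indep_pvalue_indicators)
  have "mean = real m * G b c \<beta> m t"
    using assms by (simp only: mean_def sum_expectation_pvalue_indicator)
  thus ?thesis using chernoff_upper_tail[of u v] assms by (simp only: pvalue_count_eq_sum)
qed

lemma prob_bh_threshold_less:
  assumes "0 < t" "t < 1" "0 < u" "u \<le> 1" and G_ge: "t / \<alpha> \<le> u * G b c \<beta> m t"
  shows "prob {X \<in> space sample. \<not> t \<le> bh_threshold \<alpha> m X}
    \<le> exp (- (chernoff_rate u * (real m * G b c \<beta> m t)))"
proof -
  have "real m * (t / \<alpha>) \<le> real m * (u * G b c \<beta> m t)"
    using G_ge by (intro mult_left_mono) auto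
  hence required_le: "real m * t / \<alpha> \<le> u * (real m * G b c \<beta> m t)" by (simp add: mult.left_commute)
  have "real (pvalue_count m X t) \<le> u * (real m * G b c \<beta> m t)"
    if "\<not> t \<le> bh_threshold \<alpha> m X" for X
    using bh_threshold_ge[OF alpha_bounds(1) m_pos, of t X] that required_le by linarith
  hence "prob {X \<in> space sample. \<not> t \<le> bh_threshold \<alpha> m X}
      \<le> prob {X \<in> space sample. real (pvalue_count m X t) \<le> u * (real m * G b c \<beta> m t)}"
    by (intro finite_measure_mono) auto
  also have "\<dots> \<le> exp (- (chernoff_rate u * (real m * G b c \<beta> m t)))"
    using assms by (intro prob_pvalue_count_le)
  finally show ?thesis .
qed

lemma prob_pvalue_count_at_step_ge:
  assumes "0 < t" "1 < u" and G_le: "u * G b c \<beta> m t \<le> t / \<alpha>"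
    and "k \<le> m" and s_greater: "t < \<alpha> * real k / real m"
  shows "prob {X \<in> space sample. k \<le> pvalue_count m X (\<alpha> * real k / real m)}
    \<le> exp (- (chernoff_rate u / u * real k))"
proof -
  define s where "s = \<alpha> * real k / real m"
  have "\<alpha> * real k \<le> \<alpha> * real m" using assms alpha_bounds by (intro mult_left_mono) auto
  hence "s \<le> \<alpha>" using m_pos by (simp add: s_def field_simps)
  hence s_bounds: "0 < s" "s < 1" "t \<le> s"
    using assms(1) s_greater alpha_bounds unfolding s_def by linarith+
  have "G b c \<beta> m s / s \<le> G b c \<beta> m t / t" using m1_pos assms(1) s_bounds by (intro G_div_antimono)
  also have "\<dots> \<le> 1 / (u * \<alpha>)" using G_le assms alpha_bounds by (simp add: field_simps)
  finally have "G b c \<beta> m s \<le> 1 / (u * \<alpha>) * s" using s_bounds(1) by (simp add: pos_divide_le_eq)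
  hence "real m * G b c \<beta> m s \<le> real m * (1 / (u * \<alpha>) * s)" by (intro mult_left_mono) auto
  also have "\<dots> = real k / u" using m_pos alpha_bounds by (simp add: s_def)
  finally show ?thesis
    using prob_pvalue_count_ge[OF s_bounds(1,2), of u "real k / u"] assms(2) by (simp add: s_def)
qed

text \<open>
  If the threshold is \<open>\<alpha> * k / m\<close>, then at least \<open>k\<close> p-values lie below it. As \<open>G t / t\<close> decreases,
  at most \<open>k / u\<close> are expected there when \<open>\<alpha> * k / m > t\<close>.
\<close>

lemma prob_bh_threshold_greater:
  assumes "0 < t" "1 < u" and G_le: "u * G b c \<beta> m t \<le> t / \<alpha>"
  defines "r \<equiv> chernoff_rate u / u"
  shows "prob {X \<in> space sample. \<not> bh_threshold \<alpha> m X \<le> t}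
    \<le> (1 + 1 / r) * exp (- (r * (real m * t / \<alpha>)))"
proof -
  define A where "A = {k \<in> {1..m}. t < \<alpha> * real k / real m}"
  define E where "E k = {X \<in> space sample. k \<le> pvalue_count m X (\<alpha> * real k / real m)}" for k
  have "{X \<in> space sample. \<not> bh_threshold \<alpha> m X \<le> t} \<subseteq> (\<Union>k\<in>A. E k)"
  proof safe
    fix X assume exceeds: "X \<in> space sample" "\<not> bh_threshold \<alpha> m X \<le> t"
    hence "bh_rejections \<alpha> m X \<noteq> 0" using assms(1) by (intro notI) simp
    thus "X \<in> (\<Union>k\<in>A. E k)"
      using bh_rejections_le[of \<alpha> m X] bh_rejections_le_pvalue_count[of \<alpha> m X] exceeds
      by (intro UN_I[of "bh_rejections \<alpha> m X"]) (auto simp: A_def E_def)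
  qed
  hence "prob {X \<in> space sample. \<not> bh_threshold \<alpha> m X \<le> t} \<le> prob (\<Union>k\<in>A. E k)"
    by (intro finite_measure_mono) (auto simp: A_def E_def)
  also have "\<dots> \<le> (\<Sum>k\<in>A. prob (E k))"
    by (intro finite_measure_subadditive_finite) (auto simp: A_def E_def)
  also have "\<dots> \<le> (\<Sum>k\<in>A. exp (- (r * real k)))"
    unfolding E_def r_def using assms
    by (intro sum_mono prob_pvalue_count_at_step_ge) (auto simp: A_def)
  also have "\<dots> \<le> (1 + 1 / r) * exp (- (r * (real m * t / \<alpha>)))"
  proof (rule sum_exp_tail_le)
    show "0 < r" using chernoff_rate_pos[of u] assms(2) by (simp add: r_def)
    show "real m * t / \<alpha> \<le> real k" if "k \<in> A" for k
      using that m_pos alpha_bounds by (simp add: A_def field_simps)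
  qed (simp add: A_def)
  finally show ?thesis .
qed

text \<open>
  The factor \<open>1/6\<close> in the exponents is a common lower bound of the rates \<open>1 - ln 2\<close> and
  \<open>ln 2 - 1/2\<close> that come out for \<open>t_star\<close> and \<open>t_sharp\<close>.
\<close>

lemma prob_bh_threshold_less_t_star:
  "prob {X \<in> space sample. \<not> t_star \<alpha> b c \<beta> m \<le> bh_threshold \<alpha> m X}
    \<le> exp (- (real m * t_star \<alpha> b c \<beta> m / (6 * \<alpha>)))"
proof -
  define t where "t = t_star \<alpha> b c \<beta> m"
  have t_solution: "0 < t" "t < 1" "G b c \<beta> m t = 2 / \<alpha> * t"
    using m1_pos unfolding t_def by (rule t_star_pos t_star_less_1 G_t_star)+
  have "prob {X \<in> space sample. \<not> t \<le> bh_threshold \<alpha> m X}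
      \<le> exp (- (chernoff_rate (1/2) * (real m * G b c \<beta> m t)))"
    using t_solution by (intro prob_bh_threshold_less) auto
  also have "\<dots> = exp (- ((1 - ln 2) * (real m * t / \<alpha>)))"
    using alpha_bounds by (simp add: t_solution(3) chernoff_rate_def ln_div field_simps)
  also have "\<dots> \<le> exp (- (1/6 * (real m * t / \<alpha>)))"
    unfolding exp_le_cancel_iff neg_le_iff_le using ln2_le_25_over_36 t_solution(1) alpha_bounds
    by (intro mult_right_mono) auto
  finally show ?thesis by (simp add: t_def)
qed

lemma prob_bh_threshold_greater_t_sharp:
  assumes "\<alpha> < 1/2"
  shows "prob {X \<in> space sample. \<not> bh_threshold \<alpha> m X \<le> t_sharp \<alpha> b c \<beta> m}
    \<le> 7 * exp (- (real m * t_sharp \<alpha> b c \<beta> m / (6 * \<alpha>)))"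
proof -
  define t where "t = t_sharp \<alpha> b c \<beta> m"
  have t_solution: "0 < t" "G b c \<beta> m t = 1 / (2 * \<alpha>) * t"
    using m1_pos assms unfolding t_def by (rule t_sharp_pos G_t_sharp)+
  define r :: real where "r = chernoff_rate 2 / 2"
  have r_ge: "1/6 \<le> r" using ln2_ge_two_thirds by (simp add: r_def chernoff_rate_def)
  have "prob {X \<in> space sample. \<not> bh_threshold \<alpha> m X \<le> t}
      \<le> (1 + 1 / r) * exp (- (r * (real m * t / \<alpha>)))"
    unfolding r_def using t_solution by (intro prob_bh_threshold_greater) auto
  also have "\<dots> \<le> 7 * exp (- (1/6 * (real m * t / \<alpha>)))"
  proof (intro mult_mono)
    show "1 + 1 / r \<le> 7" using r_ge by (simp add: field_simps)
    show "exp (- (r * (real m * t / \<alpha>)))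
        \<le> exp (- (1/6 * (real m * t / \<alpha>)))"
      unfolding exp_le_cancel_iff neg_le_iff_le using r_ge t_solution(1) alpha_bounds
      by (intro mult_right_mono) auto
  qed auto
  finally show ?thesis by (simp add: t_def)
qed

lemma prob_bh_threshold_ge_t_star:
  "1 - exp (- (real m * t_star \<alpha> b c \<beta> m / (6 * \<alpha>)))
    \<le> prob {X \<in> space sample. t_star \<alpha> b c \<beta> m \<le> bh_threshold \<alpha> m X}"
proof -
  have "prob {X \<in> space sample. \<not> t_star \<alpha> b c \<beta> m \<le> bh_threshold \<alpha> m X}
      = 1 - prob {X \<in> space sample. t_star \<alpha> b c \<beta> m \<le> bh_threshold \<alpha> m X}"
    by (rule prob_neg) measurable
  thus ?thesis using prob_bh_threshold_less_t_star by linarith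
qed

lemma prob_bh_threshold_between:
  assumes "\<alpha> < 1/2"
  shows "1 - 8 * exp (- (real m * t_star \<alpha> b c \<beta> m / (6 * \<alpha>)))
    \<le> prob {X \<in> space sample. t_star \<alpha> b c \<beta> m \<le> bh_threshold \<alpha> m X \<and>
        bh_threshold \<alpha> m X \<le> t_sharp \<alpha> b c \<beta> m}"
proof -
  have "exp (- (real m * t_sharp \<alpha> b c \<beta> m / (6 * \<alpha>)))
      \<le> exp (- (real m * t_star \<alpha> b c \<beta> m / (6 * \<alpha>)))"
    using t_star_le_t_sharp[OF m1_pos assms] alpha_bounds
    by (auto intro!: divide_right_mono mult_left_mono)
  moreover have "1 - prob {X \<in> space sample. \<not> t_star \<alpha> b c \<beta> m \<le> bh_threshold \<alpha> m X}
      - prob {X \<in> space sample. \<not> bh_threshold \<alpha> m X \<le> t_sharp \<alpha> b c \<beta> m}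
      \<le> prob {X \<in> space sample. t_star \<alpha> b c \<beta> m \<le> bh_threshold \<alpha> m X \<and>
          bh_threshold \<alpha> m X \<le> t_sharp \<alpha> b c \<beta> m}"
    by (rule prob_conj_ge) measurable
  ultimately show ?thesis
    using prob_bh_threshold_less_t_star prob_bh_threshold_greater_t_sharp[OF assms] by linarith
qed

end

context bh_sparse_gaussian
begin

lemma eventually_exp_t_star_le:
  "\<forall>\<^sub>F m in sequentially. exp (- (real m * t_star \<alpha> b c \<beta> m / (6 * \<alpha>)))
    \<le> exp (- deviation_rate \<alpha> b c \<beta> * real (m1 c \<beta> m)) / 4"
proof -
  define d where "d = deviation_rate \<alpha> b c \<beta>"
  have "filterlim (\<lambda>m. d * real (m1 c \<beta> m)) at_top sequentially"
    unfolding d_def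
    by (rule filterlim_tendsto_pos_mult_at_top[OF tendsto_const deviation_rate_pos filterlim_m1_at_top])
  hence "\<forall>\<^sub>F m in sequentially. ln 4 \<le> d * real (m1 c \<beta> m)"
    unfolding filterlim_at_top by blast
  with eventually_m1_pos eventually_t_star_ge show ?thesis
    unfolding d_def[symmetric]
  proof eventually_elim
    case (elim m)
    have "0 < m" using elim(1) by (rule m1_pos_imp_pos)
    hence "2 * (d * real (m1 c \<beta> m)) \<le> real m * t_star \<alpha> b c \<beta> m / (6 * \<alpha>)"
      using elim(2) alpha_bounds by (simp add: field_simps)
    hence "exp (- (real m * t_star \<alpha> b c \<beta> m / (6 * \<alpha>))) \<le> exp (- d * real (m1 c \<beta> m) - ln 4)"
      using elim(3) by simp
    thus ?case by (simp add: exp_diff)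
  qed
qed

lemma eventually_prob_bh_threshold_ge_t_star:
  "\<forall>\<^sub>F m in sequentially. \<forall>H0. null_set c \<beta> m H0 \<longrightarrow>
    1 - 2 * exp (- deviation_rate \<alpha> b c \<beta> * real (m1 c \<beta> m))
    \<le> measure (gauss_model b \<beta> m H0)
        {X \<in> space (gauss_model b \<beta> m H0). t_star \<alpha> b c \<beta> m \<le> bh_threshold \<alpha> m X}"
  using eventually_m1_pos eventually_exp_t_star_le
proof (eventually_elim, intro allI impI)
  fix m H0
  define e where "e = exp (- deviation_rate \<alpha> b c \<beta> * real (m1 c \<beta> m))"
  assume "0 < m1 c \<beta> m" "null_set c \<beta> m H0"
  then interpret bh_sparse_gaussian_sample \<alpha> b c \<beta> m H0 by unfold_locales
  assume "exp (- (real m * t_star \<alpha> b c \<beta> m / (6 * \<alpha>))) \<le> e / 4"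
  moreover have "0 < e" by (simp add: e_def)
  ultimately show "1 - 2 * e \<le> prob {X \<in> space sample. t_star \<alpha> b c \<beta> m \<le> bh_threshold \<alpha> m X}"
    using prob_bh_threshold_ge_t_star by linarith
qed

lemma eventually_prob_bh_threshold_between:
  assumes "\<alpha> < 1/2"
  shows "\<forall>\<^sub>F m in sequentially. \<forall>H0. null_set c \<beta> m H0 \<longrightarrow>
    1 - 2 * exp (- deviation_rate \<alpha> b c \<beta> * real (m1 c \<beta> m))
    \<le> measure (gauss_model b \<beta> m H0)
        {X \<in> space (gauss_model b \<beta> m H0). t_star \<alpha> b c \<beta> m \<le> bh_threshold \<alpha> m X \<and>
           bh_threshold \<alpha> m X \<le> t_sharp \<alpha> b c \<beta> m}"
  using eventually_m1_pos eventually_exp_t_star_le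
proof (eventually_elim, intro allI impI)
  fix m H0
  define e where "e = exp (- deviation_rate \<alpha> b c \<beta> * real (m1 c \<beta> m))"
  assume "0 < m1 c \<beta> m" "null_set c \<beta> m H0"
  then interpret bh_sparse_gaussian_sample \<alpha> b c \<beta> m H0 by unfold_locales
  assume "exp (- (real m * t_star \<alpha> b c \<beta> m / (6 * \<alpha>))) \<le> e / 4"
  thus "1 - 2 * e \<le> prob {X \<in> space sample. t_star \<alpha> b c \<beta> m \<le> bh_threshold \<alpha> m X \<and>
      bh_threshold \<alpha> m X \<le> t_sharp \<alpha> b c \<beta> m}"
    using prob_bh_threshold_between[OF assms] by linarith
qed

end

theorem theorem12:
  fixes \<alpha> b \<beta> :: real
  assumes "0 < \<alpha>" "\<alpha> < 1" and "0 < b" and "0 \<le> \<beta>" "\<beta> < 1"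
  shows "\<exists>d :: real \<Rightarrow> real.
    (\<forall>c\<in>{0<..<1}. 0 < d c) \<and>
    (0 < \<beta> \<longrightarrow> d constant_on {0<..<1}) \<and>
    (\<forall>c\<in>{0<..<1}.
      (\<forall>\<^sub>F m in sequentially. \<exists>!t. 0 < t \<and> t < 1 \<and> G b c \<beta> m t = 2 * t / \<alpha>) \<and>
      lesssim (\<lambda>m. real (m1 c \<beta> m) / real m) (\<lambda>m. t_star \<alpha> b c \<beta> m) \<and>
      lesssim (\<lambda>m. t_star \<alpha> b c \<beta> m) (\<lambda>m. real (m1 c \<beta> m) / real m) \<and>
      (\<forall>\<^sub>F m in sequentially. \<forall>H0. null_set c \<beta> m H0 \<longrightarrow>
        measure (gauss_model b \<beta> m H0)
          {X \<in> space (gauss_model b \<beta> m H0).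
             t_star \<alpha> b c \<beta> m \<le> \<alpha> * real (bh_rejections \<alpha> m X) / real m}
        \<ge> 1 - 2 * exp (- d c * real (m1 c \<beta> m))) \<and>
      (\<alpha> < 1/2 \<longrightarrow>
        (\<forall>\<^sub>F m in sequentially. \<exists>!t. 0 < t \<and> t < 1 \<and> G b c \<beta> m t = 0.5 * t / \<alpha>) \<and>
        (\<forall>\<^sub>F m in sequentially. t_star \<alpha> b c \<beta> m \<le> t_sharp \<alpha> b c \<beta> m) \<and>
        lesssim (\<lambda>m. t_sharp \<alpha> b c \<beta> m) (\<lambda>m. real (m1 c \<beta> m) / real m) \<and>
        (\<forall>\<^sub>F m in sequentially. \<forall>H0. null_set c \<beta> m H0 \<longrightarrow>
          measure (gauss_model b \<beta> m H0)
            {X \<in> space (gauss_model b \<beta> m H0).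
               t_star \<alpha> b c \<beta> m \<le> \<alpha> * real (bh_rejections \<alpha> m X) / real m \<and>
               \<alpha> * real (bh_rejections \<alpha> m X) / real m \<le> t_sharp \<alpha> b c \<beta> m}
          \<ge> 1 - 2 * exp (- d c * real (m1 c \<beta> m)))))"
proof -
  have model: "bh_sparse_gaussian \<alpha> b c \<beta>" if "c \<in> {0<..<1}" for c
    using assms that by unfold_locales auto
  note t_star = bh_sparse_gaussian.eventually_ex1_t_star
    bh_sparse_gaussian.signal_fraction_lesssim_t_star
    bh_sparse_gaussian.t_star_lesssim_signal_fraction
    bh_sparse_gaussian.eventually_prob_bh_threshold_ge_t_star
  note t_sharp = bh_sparse_gaussian.eventually_ex1_t_sharp
    bh_sparse_gaussian.eventually_t_star_le_t_sharp
    bh_sparse_gaussian.t_sharp_lesssim_signal_fraction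
    bh_sparse_gaussian.eventually_prob_bh_threshold_between
  show ?thesis
    by (intro exI[of _ "\<lambda>c. deviation_rate \<alpha> b c \<beta>"] conjI ballI impI
        deviation_rate_pos deviation_rate_constant_on t_star[OF model] t_sharp[OF model])
qed

end
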